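(* Let $I\subset\mathbb{N}$ and let $(\Omega_i)_{i\in I}$ be a collection of disjoint bounded domains of class $C^0$ in $\mathbb{R}^3$ such that $\Omega=\mathrm{int}\left(\bigcup_{i\in I}\bar\Omega_i\right)$ is bounded. For $J\subset I$ put $\Omega_J=\mathrm{int}\left(\bigcup_{j\in J}\bar\Omega_j\right)$. Suppose that for every nonempty $J\subset I$ there exist $x_J\in\partial\,\mathcal{U}(\Omega_J)$ and $\delta_J>0$ such that $B(x_J,\delta_J)\cap\Omega_j\neq\emptyset$ for only finitely many $j\in J$. Then for every nonempty $J\subset I$ there exist $j_0\in J$, $x_0\in\partial\,\mathcal{U}(\Omega_J)\cap\partial\Omega_{j_0}$ and $\delta>0$ such that $B(x_0,\delta)\cap\partial\,\mathcal{U}(\Omega_J)\subset\partial\Omega_{j_0}$. In particular, this conclusion holds whenever $I$ is finite.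
   Context: For a bounded set $A\subset\mathbb{R}^3$, $\mathcal{U}(A)$ denotes the (unique) unbounded connected component of $\mathbb{R}^3\setminus\bar A$. $B(x,\delta)$ is the open ball of centre $x$ and radius $\delta$, and $\mathrm{int}$ denotes the interior. A domain is a nonempty connected open set. A bounded domain $W\subset\mathbb{R}^3$ is of class $C^0$ if for any $x_0\in\partial W$ there exist a ball $B(x_0,\delta)$, $\delta>0$, an orthogonal coordinate system $(x_1,x_2,x_3)$ with origin at $x_0$, and a continuous function $f:\mathbb{R}^2\to\mathbb{R}$ such that $W\cap B(x_0,\delta)=\{x\in B(x_0,\delta): x_3>f(x_1,x_2)\}$. *)

theory Defs
  imports "HOL-Analysis.Analysis"
begin

definition is_domain :: "(real^3) set \<Rightarrow> bool" where
  "is_domain W \<longleftrightarrow> W \<noteq> {} \<and> connected W \<and> open W"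

(* An orthogonal coordinate system with origin x0 is given by an orthogonal
   transformation T of R^3: the new coordinates of x are the components of T (x - x0). *)
definition class_C0 :: "(real^3) set \<Rightarrow> bool" where
  "class_C0 W \<longleftrightarrow>
    (\<forall>x0\<in>frontier W. \<exists>\<delta>>0. \<exists>T :: real^3 \<Rightarrow> real^3. \<exists>f :: real^2 \<Rightarrow> real.
       orthogonal_transformation T \<and> continuous_on UNIV f \<and>
       W \<inter> ball x0 \<delta> =
         {x \<in> ball x0 \<delta>. T (x - x0) $ 3 > f (vector [T (x - x0) $ 1, T (x - x0) $ 2])})"

(* Meaningful for bounded A only; see ex1_unbounded_component. *)
definition unbounded_component :: "(real^3) set \<Rightarrow> (real^3) set" where
  "unbounded_component A = (THE C. C \<in> components (- closure A) \<and> \<not> bounded C)"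

lemma ex1_unbounded_component:
  fixes A :: "(real^3) set"
  assumes "bounded A"
  shows "\<exists>!C. C \<in> components (- closure A) \<and> \<not> bounded C"
proof -
  have b: "bounded (- (- closure A))"
    using assms by (simp add: bounded_closure)
  have "\<exists>C. C \<in> components (- closure A) \<and> \<not> bounded C"
    using cobounded_unbounded_components[OF b] by blast
  moreover have "C = D"
    if "C \<in> components (- closure A)" "\<not> bounded C"
       "D \<in> components (- closure A)" "\<not> bounded D" for C D
    by (rule cobounded_unique_unbounded_components[OF b]) (use that in auto)
  ultimately show ?thesis by blast
qed

definition int_union :: "(nat \<Rightarrow> (real^3) set) \<Rightarrow> nat set \<Rightarrow> (real^3) set" where
  "int_union \<Omega> J = interior (\<Union>j\<in>J. closure (\<Omega> j))"

end

theory Submission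
  imports Defs
begin

text \<open>
  Near a point where only finitely many of the domains accumulate, the frontier of the unbounded
  component is covered by the frontiers of those domains, which are closed. A finite closed cover
  of a nonempty space has a member with nonempty interior (an elementary case of Baire's theorem).
\<close>

lemma finite_closed_cover_locally_single:
  fixes S :: "'a::metric_space set"
  assumes "finite F" and "\<And>j. j \<in> F \<Longrightarrow> closed (C j)"
    and "x \<in> S" and "\<delta> > 0" and "ball x \<delta> \<inter> S \<subseteq> (\<Union>j\<in>F. C j)"
  shows "\<exists>j\<in>F. \<exists>y\<in>S \<inter> C j. \<exists>\<epsilon>>0. ball y \<epsilon> \<inter> S \<subseteq> C j"
  using assms
proof (induction F arbitrary: x \<delta> rule: finite_induct)
  case empty
  have "x \<in> ball x \<delta> \<inter> S"
    using \<open>x \<in> S\<close> \<open>\<delta> > 0\<close> by simp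
  with empty show ?case by blast
next
  case (insert a F)
  show ?case
  proof (cases "ball x \<delta> \<inter> S \<subseteq> C a")
    case True
    moreover have "x \<in> S \<inter> C a"
      using True insert.prems by auto
    ultimately show ?thesis
      using \<open>\<delta> > 0\<close> by blast
  next
    case False
    \<comment> \<open>Recentre at a point of \<open>S\<close> that \<open>C a\<close> misses. As
      \<open>C a\<close> is closed, a whole ball around \<open>y\<close> inside the old ball avoids
      it, so there the remaining sets of \<open>F\<close> cover \<open>S\<close> on their
      own.\<close>
    then obtain y where y: "y \<in> ball x \<delta> - C a" "y \<in> S" by blast
    have "open (ball x \<delta> - C a)"
      using insert.prems(1) by (simp add: open_Diff)
    then obtain \<epsilon> where \<epsilon>: "\<epsilon> > 0" "ball y \<epsilon> \<subseteq> ball x \<delta> - C a"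
      using y(1) open_contains_ball by metis
    have "ball y \<epsilon> \<inter> S \<subseteq> (\<Union>j\<in>F. C j)"
      using \<epsilon>(2) insert.prems(4) by blast
    then show ?thesis
      using insert.IH[of y \<epsilon>] insert.prems(1) y(2) \<epsilon>(1) by blast
  qed
qed

lemma unbounded_component_props:
  assumes "bounded A"
  shows "unbounded_component A \<in> components (- closure A)"
    and "\<not> bounded (unbounded_component A)"
  using theI'[OF ex1_unbounded_component[OF assms]]
  unfolding unbounded_component_def by auto

text \<open>The components of the open set \<open>- closure A\<close> are open and pairwise
  disjoint, so no point of that set can be on the frontier of one of them.\<close>

lemma frontier_unbounded_component_subset:
  assumes "bounded A"
  shows "frontier (unbounded_component A) \<subseteq> closure A"
  using frontier_of_components_closed_complement[OF closed_closure
      unbounded_component_props(1)[OF assms]]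
  by (meson closed_closure frontier_subset_closed order_trans)

text \<open>An open set that misses a set also misses its closure. Applied with \<open>V\<close> one
  of the domains, this keeps frontier points out of the domains.\<close>

lemma frontier_unbounded_component_disjoint:
  assumes "bounded A" and "open V" and "V \<subseteq> closure A"
  shows "V \<inter> frontier (unbounded_component A) = {}"
proof -
  have "V \<inter> unbounded_component A = {}"
    using in_components_subset[OF unbounded_component_props(1)[OF assms(1)]] assms(3) by blast
  then show ?thesis
    using open_Int_closure_eq_empty[OF assms(2)] by (auto simp: frontier_def)
qed

text \<open>The space is connected, so only the empty set and the whole space have empty frontier.
  Unboundedness excludes the first, a point of \<open>A\<close> the second.\<close>

lemma frontier_unbounded_component_nonempty:
  assumes "bounded A" and "A \<noteq> {}"
  shows "frontier (unbounded_component A) \<noteq> {}"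
proof -
  have "unbounded_component A \<noteq> {}"
    using unbounded_component_props(2)[OF assms(1)] by auto
  moreover have "unbounded_component A \<noteq> UNIV"
    using in_components_subset[OF unbounded_component_props(1)[OF assms(1)]]
      closure_subset[of A] assms(2) by auto
  ultimately show ?thesis
    by (simp add: frontier_eq_empty)
qed

lemma int_union_mono: "J \<subseteq> K \<Longrightarrow> int_union \<Omega> J \<subseteq> int_union \<Omega> K"
  unfolding int_union_def by (intro interior_mono) blast

lemma open_subset_int_union:
  assumes "j \<in> J" and "open (\<Omega> j)"
  shows "\<Omega> j \<subseteq> int_union \<Omega> J"
  unfolding int_union_def using assms closure_subset by (intro interior_maximal) blast+

text \<open>Passes from closures back to the domains themselves, which is what the local finiteness
  condition counts. The union may be infinite, hence the outer closure on the right.\<close>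

lemma closure_int_union_subset: "closure (int_union \<Omega> J) \<subseteq> closure (\<Union>j\<in>J. \<Omega> j)"
proof -
  have "(\<Union>j\<in>J. closure (\<Omega> j)) \<subseteq> closure (\<Union>j\<in>J. \<Omega> j)"
    by (intro UN_least closure_mono) blast
  then show ?thesis
    unfolding int_union_def by (meson closed_closure closure_minimal interior_subset order_trans)
qed

text \<open>The common core of both claims of the theorem, for one fixed \<open>J\<close>: local
  finiteness at a single frontier point is enough.\<close>

lemma frontier_locally_in_single_frontier:
  fixes \<Omega> :: "nat \<Rightarrow> (real^3) set"
  defines "S \<equiv> \<lambda>J. frontier (unbounded_component (int_union \<Omega> J))"
  assumes op: "\<And>j. j \<in> J \<Longrightarrow> open (\<Omega> j)" and bdd: "bounded (int_union \<Omega> J)"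
    and x: "x \<in> S J" and "\<delta> > 0" and fin: "finite {j \<in> J. ball x \<delta> \<inter> \<Omega> j \<noteq> {}}"
  shows "\<exists>j0\<in>J. \<exists>x0 \<in> S J \<inter> frontier (\<Omega> j0). \<exists>\<epsilon>>0. ball x0 \<epsilon> \<inter> S J \<subseteq> frontier (\<Omega> j0)"
proof -
  define F where "F = {j \<in> J. ball x \<delta> \<inter> \<Omega> j \<noteq> {}}"
  have "ball x \<delta> \<inter> S J \<subseteq> (\<Union>j\<in>F. frontier (\<Omega> j))"
  proof
    fix y assume y: "y \<in> ball x \<delta> \<inter> S J"
    have "y \<in> closure (\<Union>j\<in>J. \<Omega> j)"
      using y frontier_unbounded_component_subset[OF bdd] closure_int_union_subset
      unfolding S_def by blast
    \<comment> \<open>The ball is an open neighbourhood of \<open>y\<close>, so only what the union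
      does inside it matters.\<close>
    then have "y \<in> closure (ball x \<delta> \<inter> (\<Union>j\<in>J. \<Omega> j))"
      using y open_Int_closure_subset[OF open_ball, of x \<delta>] by blast
    also have "ball x \<delta> \<inter> (\<Union>j\<in>J. \<Omega> j) \<subseteq> (\<Union>j\<in>F. \<Omega> j)"
      unfolding F_def by blast
    \<comment> \<open>Finiteness of \<open>F\<close> enters here: a finite union of closures is
      closed, so \<open>y\<close> adheres to one particular domain instead of merely to infinitely
      many together.\<close>
    then have "closure (ball x \<delta> \<inter> (\<Union>j\<in>J. \<Omega> j)) \<subseteq> (\<Union>j\<in>F. closure (\<Omega> j))"
      using fin unfolding F_def[symmetric]
      by (intro closure_minimal closed_UN order_trans[OF _ UN_mono[OF order_refl closure_subset]]) auto
    finally obtain j where j: "j \<in> F" "y \<in> closure (\<Omega> j)" by blast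
    then have "j \<in> J" unfolding F_def by blast
    have "\<Omega> j \<subseteq> closure (int_union \<Omega> J)"
      using open_subset_int_union[OF \<open>j \<in> J\<close>, of \<Omega>] op[OF \<open>j \<in> J\<close>] closure_subset by blast
    then have "y \<notin> \<Omega> j"
      using frontier_unbounded_component_disjoint[OF bdd op[OF \<open>j \<in> J\<close>]] y
      unfolding S_def by blast
    then show "y \<in> (\<Union>j\<in>F. frontier (\<Omega> j))"
      using j op[OF \<open>j \<in> J\<close>] by (auto simp: frontier_def interior_open)
  qed
  \<comment> \<open>Finiteness is used again: the closed sets \<open>frontier (\<Omega> j)\<close>
    with \<open>j\<close> in \<open>F\<close> form a finite cover of \<open>S J\<close> near
    \<open>x\<close>.\<close>
  then have "\<exists>j\<in>F. \<exists>y\<in>S J \<inter> frontier (\<Omega> j). \<exists>\<epsilon>>0. ball y \<epsilon> \<inter> S J \<subseteq> frontier (\<Omega> j)"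
    using fin x \<open>\<delta> > 0\<close>
    by (intro finite_closed_cover_locally_single[of F _ x _ \<delta>]) (auto simp: F_def)
  then show ?thesis
    unfolding F_def by blast
qed

theorem proposition1:
  fixes I :: "nat set" and \<Omega> :: "nat \<Rightarrow> (real^3) set"
  assumes "\<And>i. i \<in> I \<Longrightarrow> is_domain (\<Omega> i)"
    and "\<And>i. i \<in> I \<Longrightarrow> bounded (\<Omega> i)"
    and "\<And>i. i \<in> I \<Longrightarrow> class_C0 (\<Omega> i)"
    and "disjoint_family_on \<Omega> I"
    and "bounded (int_union \<Omega> I)"
  shows "((\<forall>J\<subseteq>I. J \<noteq> {} \<longrightarrow>
            (\<exists>x \<in> frontier (unbounded_component (int_union \<Omega> J)). \<exists>\<delta>>0.
               finite {j \<in> J. ball x \<delta> \<inter> \<Omega> j \<noteq> {}}))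
          \<longrightarrow> (\<forall>J\<subseteq>I. J \<noteq> {} \<longrightarrow>
            (\<exists>j0\<in>J. \<exists>x0 \<in> frontier (unbounded_component (int_union \<Omega> J)) \<inter> frontier (\<Omega> j0). \<exists>\<delta>>0.
               ball x0 \<delta> \<inter> frontier (unbounded_component (int_union \<Omega> J)) \<subseteq> frontier (\<Omega> j0))))
       \<and> (finite I
          \<longrightarrow> (\<forall>J\<subseteq>I. J \<noteq> {} \<longrightarrow>
            (\<exists>j0\<in>J. \<exists>x0 \<in> frontier (unbounded_component (int_union \<Omega> J)) \<inter> frontier (\<Omega> j0). \<exists>\<delta>>0.
               ball x0 \<delta> \<inter> frontier (unbounded_component (int_union \<Omega> J)) \<subseteq> frontier (\<Omega> j0))))"
proof -
  have op: "open (\<Omega> i)" "\<Omega> i \<noteq> {}" if "i \<in> I" for i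
    using assms(1)[OF that] unfolding is_domain_def by auto
  have bdd: "bounded (int_union \<Omega> J)" if "J \<subseteq> I" for J
    using assms(5) int_union_mono[OF that] bounded_subset by blast
  have loc: "\<exists>j0\<in>J. \<exists>x0 \<in> frontier (unbounded_component (int_union \<Omega> J)) \<inter> frontier (\<Omega> j0). \<exists>\<delta>>0.
      ball x0 \<delta> \<inter> frontier (unbounded_component (int_union \<Omega> J)) \<subseteq> frontier (\<Omega> j0)"
    if "J \<subseteq> I" "x \<in> frontier (unbounded_component (int_union \<Omega> J))" "\<delta> > 0"
      "finite {j \<in> J. ball x \<delta> \<inter> \<Omega> j \<noteq> {}}" for J x \<delta>
    by (rule frontier_locally_in_single_frontier) (use that op bdd in auto)
  \<comment> \<open>For finite \<open>I\<close> no point \<open>x\<close> is given in advance; this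
    supplies one.\<close>
  have nonempty: "frontier (unbounded_component (int_union \<Omega> J)) \<noteq> {}" if J: "J \<subseteq> I" "J \<noteq> {}" for J
  proof (rule frontier_unbounded_component_nonempty[OF bdd[OF J(1)]])
    obtain j where "j \<in> J" using J(2) by blast
    then show "int_union \<Omega> J \<noteq> {}"
      using open_subset_int_union[of j J \<Omega>] op[of j] J(1) by blast
  qed
  show ?thesis
  proof (intro conjI impI allI, goal_cases)
    case (1 J)
    then obtain x \<delta> where "x \<in> frontier (unbounded_component (int_union \<Omega> J))" "\<delta> > 0"
      "finite {j \<in> J. ball x \<delta> \<inter> \<Omega> j \<noteq> {}}" by meson
    with 1 show ?case by (intro loc)
  next
    case (2 J)
    then obtain x where "x \<in> frontier (unbounded_component (int_union \<Omega> J))"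
      using nonempty by blast
    \<comment> \<open>The radius 1 is arbitrary, since \<open>J\<close> itself is finite.\<close>
    moreover have "finite {j \<in> J. ball x 1 \<inter> \<Omega> j \<noteq> {}}"
      using 2 finite_subset by fastforce
    ultimately show ?case
      using 2 by (intro loc[of J x 1]) auto
  qed
qed

end
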